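(* Let $G=(V,E,\mathbf{w},\boldsymbol{\mu})$ be a submodular hypergraph. The sequence $\{x^k\}$ generated by the inverse power method (Algorithm 2) described in the context satisfies $\mathcal{R}_1(x^{k+1})\le\mathcal{R}_1(x^k)$.
   Context: Submodular hypergraph: $V=[N]=\{1,\dots,N\}$; $E\subseteq 2^V$ is a set of hyperedges; each vertex has a weight $\mu_v>0$; each $e\in E$ carries a scalar $\vartheta_e>0$ and a function $w_e:2^e\to[0,1]$ that is submodular ($w_e(S)+w_e(T)\ge w_e(S\cup T)+w_e(S\cap T)$), satisfies $w_e(\emptyset)=0$, is symmetric ($w_e(S)=w_e(e\setminus S)$), and is normalized (the original cut weights of $e$ are divided by their maximum $\vartheta_e$, so that $\max_{S\subseteq e}w_e(S)=1$); $v\in e$ if and only if $w_e(\{v\})>0$. For $S\subseteq V$ put $w_e(S):=w_e(S\cap e)$. Lovász extension: $\mathcal{B}_e=\{y\in\mathbb{R}^N: y(S)\le w_e(S)\ \forall S\subseteq V,\ y(V)=0\}$ with $y(S)=\sum_{v\in S}y_v$; $f_e(x)=\max_{y\in\mathcal{B}_e}\langle y,x\rangle$. $Q_1(x)=\sum_{e\in E}\vartheta_e f_e(x)$; $\|x\|_{\ell_1,\mu}=\sum_v\mu_v|x_v|$; $Z_{1,\mu}(x)=\min_{c\in\mathbb{R}}\|x-c\mathbf{1}\|_{\ell_1,\mu}$; $\mathcal{R}_1(x)=Q_1(x)/Z_{1,\mu}(x)$. $\mu_1^+(x)=\sum_{v:x_v>0}\mu_v$, $\mu_1^-(x)=\sum_{v:x_v<0}\mu_v$,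 $\mu^0(x)=\sum_{v:x_v=0}\mu_v$. Algorithm 2 (inverse power method; $\|\cdot\|$ is a norm on $\mathbb{R}^N$): find a nonconstant $x^0\in\mathbb{R}^N$ such that $0\in\arg\min_c\|x^0-c\mathbf{1}\|_{\ell_1,\mu}$, and initialize $\hat\lambda^0=\mathcal{R}_1(x^0)$, $k=0$. Repeat: (i) for each $v\in V$ set $g^k_v=\mathrm{sgn}(x^k_v)\mu_v$ if $x^k_v\ne0$, and $g^k_v=-\frac{\mu_1^+(x^k)-\mu_1^-(x^k)}{\mu^0(x^k)}\mu_v$ if $x^k_v=0$; (ii) $z^{k+1}\leftarrow\arg\min_{z:\|z\|\le1}Q_1(z)-\hat\lambda^k\langle z,g^k\rangle$; (iii) $c^{k+1}\leftarrow\arg\min_{c}\|z^{k+1}-c\mathbf{1}\|_{\ell_1,\mu}$; (iv) $x^{k+1}\leftarrow z^{k+1}-c^{k+1}\mathbf{1}$; (v) $\hat\lambda^{k+1}\leftarrow\mathcal{R}_1(x^{k+1})$; until $|\hat\lambda^{k+1}-\hat\lambda^k|/\hat\lambda^k<\epsilon$. Output $x^{k+1}$. *)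

theory Defs
  imports "HOL-Analysis.Analysis"
begin

text \<open>
  The vertex set \<open>V = [N]\<close> is the universe of a finite type \<open>'n\<close>, and \<open>real ^ 'n\<close> plays the role
  of the space of real vectors indexed by \<open>V\<close>. The value \<open>w e S\<close> is meaningful only for \<open>S \<subseteq> e\<close>.
\<close>

definition cut_weight :: "('n set \<Rightarrow> 'n set \<Rightarrow> real) \<Rightarrow> 'n set \<Rightarrow> 'n set \<Rightarrow> real" where
  "cut_weight w e S = w e (S \<inter> e)"

locale submodular_hypergraph =
  fixes E :: "'n::finite set set"
    and \<mu> :: "'n \<Rightarrow> real"
    and \<theta> :: "'n set \<Rightarrow> real"
    and w :: "'n set \<Rightarrow> 'n set \<Rightarrow> real"
  assumes vertex_weight_pos: "\<And>v. \<mu> v > 0"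
    and edge_scalar_pos: "\<And>e. e \<in> E \<Longrightarrow> \<theta> e > 0"
    and range_01: "\<And>e S. e \<in> E \<Longrightarrow> S \<subseteq> e \<Longrightarrow> w e S \<in> {0..1}"
    and submodular: "\<And>e S T. e \<in> E \<Longrightarrow> S \<subseteq> e \<Longrightarrow> T \<subseteq> e \<Longrightarrow>
                       w e S + w e T \<ge> w e (S \<union> T) + w e (S \<inter> T)"
    and empty_zero: "\<And>e. e \<in> E \<Longrightarrow> w e {} = 0"
    and symmetric: "\<And>e S. e \<in> E \<Longrightarrow> S \<subseteq> e \<Longrightarrow> w e S = w e (e - S)"
    and normalized: "\<And>e. e \<in> E \<Longrightarrow> Max (w e ` Pow e) = 1"
    and incidence: "\<And>e v. e \<in> E \<Longrightarrow> v \<in> e \<longleftrightarrow> cut_weight w e {v} > 0"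

definition base_polytope :: "('n::finite set \<Rightarrow> 'n set \<Rightarrow> real) \<Rightarrow> 'n set \<Rightarrow> (real ^ 'n) set" where
  "base_polytope w e =
     {y. (\<forall>S. (\<Sum>v\<in>S. y $ v) \<le> cut_weight w e S) \<and> (\<Sum>v\<in>UNIV. y $ v) = 0}"

text \<open>
  In a submodular hypergraph the base polytope is compact and contains \<open>0\<close>, so the supremum
  below is a maximum.
\<close>

definition lovasz_ext :: "('n::finite set \<Rightarrow> 'n set \<Rightarrow> real) \<Rightarrow> 'n set \<Rightarrow> real ^ 'n \<Rightarrow> real" where
  "lovasz_ext w e x = (SUP y\<in>base_polytope w e. y \<bullet> x)"

definition Q1 :: "'n::finite set set \<Rightarrow> ('n set \<Rightarrow> real) \<Rightarrow> ('n set \<Rightarrow> 'n set \<Rightarrow> real) \<Rightarrow> real ^ 'n \<Rightarrow> real" where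
  "Q1 E \<theta> w x = (\<Sum>e\<in>E. \<theta> e * lovasz_ext w e x)"

definition l1_norm :: "('n::finite \<Rightarrow> real) \<Rightarrow> real ^ 'n \<Rightarrow> real" where
  "l1_norm \<mu> x = (\<Sum>v\<in>UNIV. \<mu> v * \<bar>x $ v\<bar>)"

text \<open>
  For positive \<open>\<mu>\<close> the infimum below is attained (at any weighted median of \<open>x\<close>), so it is a
  minimum.
\<close>

definition Z1 :: "('n::finite \<Rightarrow> real) \<Rightarrow> real ^ 'n \<Rightarrow> real" where
  "Z1 \<mu> x = (INF c. l1_norm \<mu> (x - c *\<^sub>R 1))"

text \<open>
  \<open>Z1 \<mu> x\<close> vanishes exactly for constant \<open>x\<close>; there the quotient is mathematically undefined
  and gets the value \<open>0\<close> of division by zero in HOL.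
\<close>

definition R1 ::
  "'n::finite set set \<Rightarrow> ('n \<Rightarrow> real) \<Rightarrow> ('n set \<Rightarrow> real) \<Rightarrow> ('n set \<Rightarrow> 'n set \<Rightarrow> real) \<Rightarrow> real ^ 'n \<Rightarrow> real" where
  "R1 E \<mu> \<theta> w x = Q1 E \<theta> w x / Z1 \<mu> x"

definition mu_pos :: "('n::finite \<Rightarrow> real) \<Rightarrow> real ^ 'n \<Rightarrow> real" where
  "mu_pos \<mu> x = (\<Sum>v | x $ v > 0. \<mu> v)"

definition mu_neg :: "('n::finite \<Rightarrow> real) \<Rightarrow> real ^ 'n \<Rightarrow> real" where
  "mu_neg \<mu> x = (\<Sum>v | x $ v < 0. \<mu> v)"

definition mu_zero :: "('n::finite \<Rightarrow> real) \<Rightarrow> real ^ 'n \<Rightarrow> real" where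
  "mu_zero \<mu> x = (\<Sum>v | x $ v = 0. \<mu> v)"

definition ipm_g :: "('n::finite \<Rightarrow> real) \<Rightarrow> real ^ 'n \<Rightarrow> real ^ 'n" where
  "ipm_g \<mu> x = (\<chi> v. if x $ v \<noteq> 0 then sgn (x $ v) * \<mu> v
                     else - ((mu_pos \<mu> x - mu_neg \<mu> x) / mu_zero \<mu> x) * \<mu> v)"

definition is_norm :: "('a::real_vector \<Rightarrow> real) \<Rightarrow> bool" where
  "is_norm nm \<longleftrightarrow> (\<forall>x. nm x \<ge> 0) \<and> (\<forall>x. nm x = 0 \<longleftrightarrow> x = 0) \<and>
     (\<forall>a x. nm (a *\<^sub>R x) = \<bar>a\<bar> * nm x) \<and> (\<forall>x y. nm (x + y) \<le> nm x + nm y)"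

text \<open>
  \<open>ipm_run E \<mu> \<theta> w nm \<epsilon> n x\<close>: the vectors \<open>x 0, \<dots>, x n\<close> are iterates of a run of the inverse
  power method with tolerance \<open>\<epsilon>\<close> that performs at least \<open>n\<close> iterations, i.e. the stopping test
  has failed after each iteration before the \<open>n\<close>-th one. The minimisers in the algorithm need not
  be unique; any choice of them is admitted. A run that never stops is covered by its finite
  prefixes, and with \<open>\<epsilon> \<le> 0\<close> the stopping test is never met.
\<close>

definition ipm_run ::
  "'n::finite set set \<Rightarrow> ('n \<Rightarrow> real) \<Rightarrow> ('n set \<Rightarrow> real) \<Rightarrow> ('n set \<Rightarrow> 'n set \<Rightarrow> real) \<Rightarrow>
   (real ^ 'n \<Rightarrow> real) \<Rightarrow> real \<Rightarrow> nat \<Rightarrow> (nat \<Rightarrow> real ^ 'n) \<Rightarrow> bool" where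
  "ipm_run E \<mu> \<theta> w nm \<epsilon> n x \<longleftrightarrow>
     (\<exists>(lam :: nat \<Rightarrow> real) (g :: nat \<Rightarrow> real ^ 'n) (z :: nat \<Rightarrow> real ^ 'n) (c :: nat \<Rightarrow> real).
        (\<nexists>a. x 0 = a *\<^sub>R 1) \<and>
        is_arg_min (\<lambda>a. l1_norm \<mu> (x 0 - a *\<^sub>R 1)) (\<lambda>_. True) 0 \<and>
        lam 0 = R1 E \<mu> \<theta> w (x 0) \<and>
        (\<forall>k<n.
           g k = ipm_g \<mu> (x k) \<and>
           is_arg_min (\<lambda>u. Q1 E \<theta> w u - lam k * (u \<bullet> g k)) (\<lambda>u. nm u \<le> 1) (z (Suc k)) \<and>
           is_arg_min (\<lambda>a. l1_norm \<mu> (z (Suc k) - a *\<^sub>R 1)) (\<lambda>_. True) (c (Suc k)) \<and>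
           x (Suc k) = z (Suc k) - c (Suc k) *\<^sub>R 1 \<and>
           lam (Suc k) = R1 E \<mu> \<theta> w (x (Suc k))) \<and>
        (\<forall>k. Suc k < n \<longrightarrow> \<not> \<bar>lam (Suc k) - lam k\<bar> / lam k < \<epsilon>))"

end

theory Submission
  imports Defs
begin

text \<open>
  Since \<open>0\<close> is feasible in step (ii), \<open>Q1 z \<le> lam * (z \<bullet> g)\<close> for the new \<open>z\<close>. As \<open>0\<close> is a weighted
  median of the current iterate, \<open>\<bar>g v\<bar> \<le> \<mu> v\<close> and the entries of \<open>g\<close> sum to \<open>0\<close>, so
  \<open>z \<bullet> g = (z - c 1) \<bullet> g\<close> is at most the weighted norm of \<open>z - c 1\<close>, which is \<open>Z1\<close> of the next
  iterate because \<open>c\<close> is a weighted median of \<open>z\<close>. Invariance of \<open>Q1\<close> under constant shifts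
  turns this into \<open>R1 \<le> lam\<close> at the next iterate. The value \<open>R1 = 0\<close> at constant vectors does no
  harm because \<open>lam \<ge> 0\<close>.
\<close>

text \<open>The invariant of the iteration: 0 is a weighted median of every iterate.\<close>

definition zero_median :: "('n::finite \<Rightarrow> real) \<Rightarrow> real ^ 'n \<Rightarrow> bool" where
  "zero_median \<mu> x \<longleftrightarrow> (\<forall>a. l1_norm \<mu> x \<le> l1_norm \<mu> (x - a *\<^sub>R 1))"

lemma zero_median_iff_is_arg_min:
  "zero_median \<mu> (x - c *\<^sub>R 1) \<longleftrightarrow> is_arg_min (\<lambda>a. l1_norm \<mu> (x - a *\<^sub>R 1)) (\<lambda>_. True) c"
proof -
  have "x - c *\<^sub>R 1 - a *\<^sub>R 1 = x - (c + a) *\<^sub>R 1" for a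
    by (simp add: scaleR_add_left)
  then have "zero_median \<mu> (x - c *\<^sub>R 1) \<longleftrightarrow>
      (\<forall>a. l1_norm \<mu> (x - c *\<^sub>R 1) \<le> l1_norm \<mu> (x - (c + a) *\<^sub>R 1))"
    by (simp only: zero_median_def)
  also have "\<dots> \<longleftrightarrow> (\<forall>b. l1_norm \<mu> (x - c *\<^sub>R 1) \<le> l1_norm \<mu> (x - b *\<^sub>R 1))"
    by (metis add.commute diff_add_cancel)
  finally show ?thesis
    by (auto simp: is_arg_min_def not_less)
qed

text \<open>Reflection lets a bound on the right derivative at 0 serve for the left derivative
  too.\<close>

lemma zero_median_uminus:
  assumes "zero_median \<mu> x"
  shows "zero_median \<mu> (- x)"
  unfolding zero_median_def
proof
  fix a :: real
  have even: "l1_norm \<mu> (- y) = l1_norm \<mu> y" for y :: "real ^ 'a"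
    by (simp add: l1_norm_def)
  have "l1_norm \<mu> (- x - a *\<^sub>R 1) = l1_norm \<mu> (- (x - (- a) *\<^sub>R 1))"
    by (rule arg_cong[where f = "l1_norm \<mu>"]) simp
  then show "l1_norm \<mu> (- x) \<le> l1_norm \<mu> (- x - a *\<^sub>R 1)"
    using assms unfolding even zero_median_def by metis
qed

lemma Z1_eq_l1_norm:
  assumes "zero_median \<mu> x"
  shows "Z1 \<mu> x = l1_norm \<mu> x"
  unfolding Z1_def
proof (rule cInf_eq_minimum)
  show "l1_norm \<mu> x \<in> range (\<lambda>c. l1_norm \<mu> (x - c *\<^sub>R 1))"
    by (rule range_eqI[where x = 0]) simp
qed (use assms in \<open>auto simp: zero_median_def\<close>)

lemma Z1_nonneg:
  assumes "\<And>v. 0 \<le> \<mu> v"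
  shows "0 \<le> Z1 \<mu> x"
  unfolding Z1_def l1_norm_def
  by (rule cINF_greatest) (auto intro!: sum_nonneg mult_nonneg_nonneg assms)

text \<open>
  The right derivative of \<open>a \<mapsto> l1_norm \<mu> (x - a *\<^sub>R 1)\<close> at \<open>0\<close> is \<open>mu_neg + mu_zero - mu_pos\<close>.
\<close>

lemma mu_pos_minus_mu_neg_le_mu_zero:
  assumes "zero_median \<mu> x"
  shows "mu_pos \<mu> x - mu_neg \<mu> x \<le> mu_zero \<mu> x"
proof -
  \<comment> \<open>A shift by \<open>d\<close> takes no positive entry below 0, so the norm is
    affine on [0, \<open>d\<close>]. The inserted 1 keeps the set nonempty when no entry is
    positive.\<close>
  define d where "d = Min (insert 1 {x $ v |v. x $ v > 0})"
  have fin: "finite {x $ v |v. x $ v > 0}"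
    by simp
  have d_pos: "d > 0"
    unfolding d_def using fin by (subst Min_gr_iff) auto
  have d_le: "d \<le> x $ v" if "x $ v > 0" for v
    unfolding d_def using fin that by (intro Min_le) auto
  have "0 \<le> l1_norm \<mu> (x - d *\<^sub>R 1) - l1_norm \<mu> x"
    using assms by (simp add: zero_median_def)
  also have "\<dots> = (\<Sum>v\<in>UNIV. d * ((if x $ v = 0 then \<mu> v else 0)
      + (if x $ v < 0 then \<mu> v else 0) - (if x $ v > 0 then \<mu> v else 0)))"
    unfolding l1_norm_def sum_subtractf[symmetric]
  proof (rule sum.cong)
    fix v
    show "\<mu> v * \<bar>(x - d *\<^sub>R 1) $ v\<bar> - \<mu> v * \<bar>x $ v\<bar> = d * ((if x $ v = 0 then \<mu> v else 0)
      + (if x $ v < 0 then \<mu> v else 0) - (if x $ v > 0 then \<mu> v else 0))"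
      using d_pos d_le[of v]
      by (cases "x $ v" "0 :: real" rule: linorder_cases) (auto simp: algebra_simps)
  qed simp
  also have "\<dots> = d * (mu_zero \<mu> x + mu_neg \<mu> x - mu_pos \<mu> x)"
    by (simp add: mu_zero_def mu_neg_def mu_pos_def sum_distrib_left[symmetric] sum.distrib
        sum_subtractf sum.If_cases)
  finally show ?thesis
    using d_pos by (simp add: zero_le_mult_iff)
qed

text \<open>Negating \<open>x\<close> swaps \<open>mu_pos\<close> and \<open>mu_neg\<close> and
  fixes \<open>mu_zero\<close>.\<close>

lemma abs_mu_pos_minus_mu_neg_le_mu_zero:
  assumes "zero_median \<mu> x"
  shows "\<bar>mu_pos \<mu> x - mu_neg \<mu> x\<bar> \<le> mu_zero \<mu> x"
  using mu_pos_minus_mu_neg_le_mu_zero[OF assms]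
    mu_pos_minus_mu_neg_le_mu_zero[OF zero_median_uminus[OF assms]]
  by (simp add: mu_pos_def mu_neg_def mu_zero_def)

lemma abs_ipm_g_le:
  assumes "\<And>v. 0 \<le> \<mu> v" and "zero_median \<mu> x"
  shows "\<bar>ipm_g \<mu> x $ v\<bar> \<le> \<mu> v"
proof (cases "x $ v = 0")
  case True
  define r where "r = (mu_pos \<mu> x - mu_neg \<mu> x) / mu_zero \<mu> x"
  have "\<bar>r\<bar> \<le> 1"
    using abs_mu_pos_minus_mu_neg_le_mu_zero[OF assms(2)]
    by (auto simp: r_def divide_le_eq)
  then have "\<bar>r * \<mu> v\<bar> \<le> \<mu> v"
    using assms(1)[of v] by (simp add: abs_mult mult_left_le_one_le)
  then show ?thesis
    using True by (simp add: ipm_g_def r_def)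
next
  case False
  then show ?thesis
    using assms(1)[of v] by (simp add: ipm_g_def abs_mult abs_sgn_eq)
qed

lemma sum_ipm_g:
  assumes "zero_median \<mu> x"
  shows "(\<Sum>v\<in>UNIV. ipm_g \<mu> x $ v) = 0"
proof -
  define r where "r = (mu_pos \<mu> x - mu_neg \<mu> x) / mu_zero \<mu> x"
  have "(\<Sum>v\<in>UNIV. ipm_g \<mu> x $ v) = (\<Sum>v\<in>UNIV. (if x $ v > 0 then \<mu> v else 0)
      - (if x $ v < 0 then \<mu> v else 0) - r * (if x $ v = 0 then \<mu> v else 0))"
    by (intro sum.cong) (auto simp: ipm_g_def r_def sgn_if)
  also have "\<dots> = mu_pos \<mu> x - mu_neg \<mu> x - r * mu_zero \<mu> x"
    by (simp add: mu_zero_def mu_neg_def mu_pos_def sum_distrib_left[symmetric]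
        sum_subtractf sum.If_cases)
  \<comment> \<open>If \<open>mu_zero\<close> is 0, then \<open>r\<close> is 0 by division by zero,
    but the median bound forces \<open>mu_pos\<close> and \<open>mu_neg\<close> to agree.\<close>
  also have "\<dots> = 0"
    using abs_mu_pos_minus_mu_neg_le_mu_zero[OF assms] by (auto simp: r_def)
  finally show ?thesis .
qed

text \<open>Duality of the weighted l1 norm with the bound \<open>abs_ipm_g_le\<close> on the
  entries.\<close>

lemma inner_ipm_g_le_l1_norm:
  assumes "\<And>v. 0 \<le> \<mu> v" and "zero_median \<mu> x"
  shows "z \<bullet> ipm_g \<mu> x \<le> l1_norm \<mu> z"
  unfolding inner_vec_def l1_norm_def
proof (rule sum_mono)
  fix v
  have "z $ v * ipm_g \<mu> x $ v \<le> \<bar>z $ v\<bar> * \<bar>ipm_g \<mu> x $ v\<bar>"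
    by (metis abs_ge_self abs_mult)
  also have "\<dots> \<le> \<mu> v * \<bar>z $ v\<bar>"
    using abs_ipm_g_le[OF assms, of v] by (subst mult.commute) (rule mult_right_mono, simp_all)
  finally show "z $ v \<bullet> ipm_g \<mu> x $ v \<le> \<mu> v * \<bar>z $ v\<bar>"
    by simp
qed

lemma inner_one_eq_sum: "y \<bullet> (1 :: real ^ 'n::finite) = (\<Sum>v\<in>UNIV. y $ v)"
  by (simp add: inner_vec_def)

text \<open>Points of the base polytope have entry sum 0, so they are orthogonal to the constant
  vectors.\<close>

lemma lovasz_ext_shift: "lovasz_ext w e (x - c *\<^sub>R 1) = lovasz_ext w e x"
  unfolding lovasz_ext_def
  by (rule SUP_cong) (auto simp: inner_diff_right inner_one_eq_sum base_polytope_def)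

lemma Q1_shift: "Q1 E \<theta> w (x - c *\<^sub>R 1) = Q1 E \<theta> w x"
  by (simp add: Q1_def lovasz_ext_shift)

context submodular_hypergraph
begin

lemma cut_weight_bounds:
  assumes "e \<in> E"
  shows "0 \<le> cut_weight w e S" "cut_weight w e S \<le> 1"
  using range_01[OF assms, of "S \<inter> e"] by (auto simp: cut_weight_def)

lemma zero_in_base_polytope: "e \<in> E \<Longrightarrow> 0 \<in> base_polytope w e"
  by (simp add: base_polytope_def cut_weight_bounds)

text \<open>The constraint at \<open>{v}\<close> bounds the entry above; since all entries sum to 0,
  the constraint at the complement bounds it below.\<close>

lemma base_polytope_abs_le_1:
  assumes "e \<in> E" and "y \<in> base_polytope w e"
  shows "\<bar>y $ v\<bar> \<le> 1"
proof -
  have le: "(\<Sum>u\<in>S. y $ u) \<le> 1" for S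
    using assms(2) by (intro order_trans[OF _ cut_weight_bounds(2)[OF assms(1), of S]])
      (simp add: base_polytope_def)
  have "y $ v + (\<Sum>u\<in>UNIV - {v}. y $ u) = 0"
    using assms(2) by (simp add: base_polytope_def sum.remove[of UNIV v])
  with le[of "{v}"] le[of "UNIV - {v}"] show ?thesis
    by simp
qed

text \<open>Without boundedness a real \<open>SUP\<close> need not dominate its members.\<close>

lemma bdd_above_inner_base_polytope:
  assumes "e \<in> E"
  shows "bdd_above ((\<lambda>y. y \<bullet> x) ` base_polytope w e)"
proof (rule bdd_aboveI2)
  fix y
  assume y: "y \<in> base_polytope w e"
  show "y \<bullet> x \<le> (\<Sum>v\<in>UNIV. \<bar>x $ v\<bar>)"
    unfolding inner_vec_def
  proof (rule sum_mono)
    fix v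
    have "y $ v * x $ v \<le> \<bar>y $ v\<bar> * \<bar>x $ v\<bar>"
      by (metis abs_ge_self abs_mult)
    also have "\<dots> \<le> \<bar>x $ v\<bar>"
      using base_polytope_abs_le_1[OF assms y] by (intro mult_left_le_one_le) auto
    finally show "y $ v \<bullet> x $ v \<le> \<bar>x $ v\<bar>"
      by simp
  qed
qed

lemma lovasz_ext_nonneg:
  assumes "e \<in> E"
  shows "0 \<le> lovasz_ext w e x"
  unfolding lovasz_ext_def
  using cSUP_upper[OF zero_in_base_polytope[OF assms] bdd_above_inner_base_polytope[OF assms]]
  by simp

lemma lovasz_ext_zero:
  assumes "e \<in> E"
  shows "lovasz_ext w e 0 = 0"
proof -
  have "base_polytope w e \<noteq> {}"
    using zero_in_base_polytope[OF assms] by blast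
  then show ?thesis
    by (simp add: lovasz_ext_def)
qed

lemma Q1_nonneg: "0 \<le> Q1 E \<theta> w x"
  unfolding Q1_def
  by (intro sum_nonneg mult_nonneg_nonneg)
    (auto simp: lovasz_ext_nonneg less_imp_le[OF edge_scalar_pos])

lemma Q1_zero: "Q1 E \<theta> w 0 = 0"
  by (simp add: Q1_def lovasz_ext_zero)

lemma R1_nonneg: "0 \<le> R1 E \<mu> \<theta> w x"
  by (simp add: R1_def Q1_nonneg Z1_nonneg less_imp_le[OF vertex_weight_pos])

lemma R1_ipm_step_le:
  assumes "nm 0 \<le> 1" and "0 \<le> l" and "zero_median \<mu> x"
    and z: "is_arg_min (\<lambda>u. Q1 E \<theta> w u - l * (u \<bullet> ipm_g \<mu> x)) (\<lambda>u. nm u \<le> 1) z"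
    and "zero_median \<mu> (z - c *\<^sub>R 1)"
  shows "R1 E \<mu> \<theta> w (z - c *\<^sub>R 1) \<le> l"
proof -
  let ?x' = "z - c *\<^sub>R 1"
  have \<mu>: "0 \<le> \<mu> v" for v
    by (simp add: less_imp_le[OF vertex_weight_pos])
  \<comment> \<open>The entries of \<open>ipm_g\<close> sum to 0, so the shift by \<open>c\<close>
    is invisible.\<close>
  have "z \<bullet> ipm_g \<mu> x = ?x' \<bullet> ipm_g \<mu> x"
    using sum_ipm_g[OF assms(3)]
    by (simp add: inner_diff_left inner_commute[of 1] inner_one_eq_sum)
  also have "\<dots> \<le> Z1 \<mu> ?x'"
    using inner_ipm_g_le_l1_norm[OF \<mu> assms(3)] Z1_eq_l1_norm[OF assms(5)] by simp
  finally have "l * (z \<bullet> ipm_g \<mu> x) \<le> l * Z1 \<mu> ?x'"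
    using assms(2) by (rule mult_left_mono)
  \<comment> \<open>Compare the minimiser with the feasible point 0, where the objective is
    0.\<close>
  moreover have "Q1 E \<theta> w z \<le> l * (z \<bullet> ipm_g \<mu> x)"
    using z assms(1) Q1_zero by (force simp: is_arg_min_def)
  ultimately have "Q1 E \<theta> w ?x' \<le> l * Z1 \<mu> ?x'"
    by (simp add: Q1_shift)
  moreover have "0 \<le> Z1 \<mu> ?x'"
    by (rule Z1_nonneg[OF \<mu>])
  \<comment> \<open>If \<open>Z1\<close> vanishes, the quotient is 0 by convention and
    \<open>0 \<le> l\<close> suffices.\<close>
  ultimately show ?thesis
    using assms(2) by (cases "Z1 \<mu> ?x' = 0") (auto simp: R1_def divide_le_eq)
qed

end

theorem theorem4p6:
  fixes E :: "'n::finite set set"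
    and \<mu> :: "'n \<Rightarrow> real"
    and \<theta> :: "'n set \<Rightarrow> real"
    and w :: "'n set \<Rightarrow> 'n set \<Rightarrow> real"
    and nm :: "real ^ 'n \<Rightarrow> real"
    and \<epsilon> :: real
    and n k :: nat
    and x :: "nat \<Rightarrow> real ^ 'n"
  assumes "submodular_hypergraph E \<mu> \<theta> w"
    and "is_norm nm"
    and "ipm_run E \<mu> \<theta> w nm \<epsilon> n x"
    and "k < n"
  shows "R1 E \<mu> \<theta> w (x (Suc k)) \<le> R1 E \<mu> \<theta> w (x k)"
proof -
  interpret submodular_hypergraph E \<mu> \<theta> w
    by (rule assms(1))
  obtain lam g z c where
    x0: "is_arg_min (\<lambda>a. l1_norm \<mu> (x 0 - a *\<^sub>R 1)) (\<lambda>_. True) 0" and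
    lam0: "lam 0 = R1 E \<mu> \<theta> w (x 0)" and
    g: "\<And>j. j < n \<Longrightarrow> g j = ipm_g \<mu> (x j)" and
    z: "\<And>j. j < n \<Longrightarrow>
      is_arg_min (\<lambda>u. Q1 E \<theta> w u - lam j * (u \<bullet> g j)) (\<lambda>u. nm u \<le> 1) (z (Suc j))" and
    c: "\<And>j. j < n \<Longrightarrow>
      is_arg_min (\<lambda>a. l1_norm \<mu> (z (Suc j) - a *\<^sub>R 1)) (\<lambda>_. True) (c (Suc j))" and
    x_Suc: "\<And>j. j < n \<Longrightarrow> x (Suc j) = z (Suc j) - c (Suc j) *\<^sub>R 1" and
    lam_Suc: "\<And>j. j < n \<Longrightarrow> lam (Suc j) = R1 E \<mu> \<theta> w (x (Suc j))"
    using assms(3) unfolding ipm_run_def by blast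
  \<comment> \<open>For \<open>j = 0\<close> this is the initial condition, afterwards the choice of
    \<open>c\<close> in step (iii). The range includes \<open>n\<close> because \<open>Suc k\<close>
    may equal \<open>n\<close>.\<close>
  have median: "zero_median \<mu> (x j)" if "j \<le> n" for j
  proof (cases j)
    case 0
    then show ?thesis
      using x0 zero_median_iff_is_arg_min[of \<mu> "x 0" 0] by simp
  next
    case (Suc i)
    then show ?thesis
      using c[of i] x_Suc[of i] that by (simp add: zero_median_iff_is_arg_min)
  qed
  have lam: "lam k = R1 E \<mu> \<theta> w (x k)"
    using lam0 lam_Suc assms(4) by (cases k) auto
  have "nm 0 \<le> 1"
    using assms(2) by (metis is_norm_def zero_le_one)
  moreover have "is_arg_min (\<lambda>u. Q1 E \<theta> w u - R1 E \<mu> \<theta> w (x k) * (u \<bullet> ipm_g \<mu> (x k)))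
      (\<lambda>u. nm u \<le> 1) (z (Suc k))"
    using z[OF assms(4)] g[OF assms(4)] lam by simp
  ultimately show ?thesis
    using R1_ipm_step_le[OF _ R1_nonneg, of nm "x k" "x k" "z (Suc k)" "c (Suc k)"]
      median[of k] median[of "Suc k"] x_Suc[OF assms(4)] assms(4)
    by simp
qed

end
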